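(* There exist constants $C,N_0,\kappa_0>0$ such that for every $N\ge N_0$ and every invertible symmetric matrix $A\in\mathbb{R}^{N\times N}$ with condition number $\kappa(A)\ge\kappa_0$, the randomized procedure $\mathrm{Solver}(A)$ (defined in the context) satisfies the following. Let $N_{\mathrm{for}}$ be the total number of multiplications by $A$ and $N_{\mathrm{inv}}$ the total number of multiplications by an inverse of $A$ or of a shifted matrix $A+sI$, $s>0$, used by the power iterations of the procedure (so a multiplication by $A^2$ counts as two multiplications by $A$, a multiplication by $A^{-2}$ as two multiplications by $A^{-1}$, and a multiplication by a matrix $Z$ of step 4 as one multiplication by a shifted inverse of $A$). Then $$N_{\mathrm{for}}\le C\log(N),$$ and, with probability greater than $1-10^{-9}$ over the random starting vectors, $$N_{\mathrm{inv}}\le C\,\log(N)\cdot\big(\log\kappa(A)\big)^2\cdot\log\big(\log(1+\kappa(A))\big).$$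
   Context: For invertible $A$, $\kappa(A):=\|A\|_2\cdot\|A^{-1}\|_2$. $B_N$ denotes a random oracle: each call returns a vector distributed uniformly on the unit sphere of $\mathbb{R}^N$, with different calls independent. $\mathrm{PowerIteration}(G,b,k)$, for symmetric invertible $G\in\mathbb{R}^{N\times N}$, $b\in\mathbb{R}^N\setminus\{0\}$ and an integer $k\ge 0$: set $v:=b$; for $j=0,1,\dots,k$ do $b:=v/\|v\|_2$, $v:=Gb$, $\tilde\lambda:=\langle v,b\rangle/\langle b,b\rangle$. Return $\tilde\lambda$ (the last value computed). $\mathrm{Solver}(A)$, with a fresh call of $B_N$ for each power iteration: 1. $k:=\lceil 2.9\log_{10}(N)+54.1\rceil$. 2. $\check\mu>0$ is defined by $\check\mu^2:=0.5/\mathrm{PowerIteration}(A^{-2},B_N,k)$, and $\hat\mu>0$ by $\hat\mu^2:=1.5\cdot\mathrm{PowerIteration}(A^{2},B_N,k)$. 3. $J:=\lceil\log_2(\hat\mu/\check\mu)\rceil$. If $J\ge 1$, redefine $k:=\lceil 2.9\log_{10}(N)+1.8\log_2(J)+40.3\rceil$. 4. For $j=0,1,\dots,J-1$ (no iterations if $J\le 0$): set $\mu:=1+2^{-j}$ and $Z:=(\mu-1)\big((\mu-1)I+\tfrac{1}{\hat\mu}A\big)^{-1}$; compute $\tilde\lambda:=\mathrm{PowerIteration}(Z,B_N,k)$; if $\tilde\lambda\ge 1$, stop and answer "not positive definite". 5. If the loop ends without stopping, answer "positive definite". If at some point the matrix to be inverted in step 4 is singular, the run stops. *)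

theory Defs
  imports
    "HOL-Probability.Probability"
    "Jordan_Normal_Form.Gauss_Jordan_Elimination"
begin

text \<open>
  The dimension \<open>N\<close> is quantified inside the theorem (the constants must not depend on it), so
  vectors and matrices are the dimension-carrying types of \<open>Jordan_Normal_Form\<close>.
  In both source libraries \<open>vec\<close>, \<open>mat\<close> and \<open>$\<close> exist; below they mean those of
  \<open>Jordan_Normal_Form\<close>.
\<close>

no_notation vec_nth (infixl "$" 90)
no_notation inner (infixl "\<bullet>" 70)
hide_const (open) Finite_Cartesian_Product.vec Finite_Cartesian_Product.mat

definition l2_norm :: "real vec \<Rightarrow> real" where
  "l2_norm v = sqrt (v \<bullet> v)"

definition spectral_norm :: "real mat \<Rightarrow> real" where
  "spectral_norm A = (SUP v \<in> {v \<in> carrier_vec (dim_col A). l2_norm v = 1}. l2_norm (A *\<^sub>v v))"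

definition symmetric_mat :: "real mat \<Rightarrow> bool" where
  "symmetric_mat A \<longleftrightarrow> transpose_mat A = A"

text \<open>Unspecified unless \<open>A\<close> is square and invertible.\<close>

definition inverse_mat :: "real mat \<Rightarrow> real mat" where
  "inverse_mat A = the (mat_inverse A)"

definition condition_number :: "real mat \<Rightarrow> real" where
  "condition_number A = spectral_norm A * spectral_norm (inverse_mat A)"

definition borel_vec :: "nat \<Rightarrow> real vec measure" where
  "borel_vec N =
     vimage_algebra (carrier_vec N) (\<lambda>v. restrict (vec_index v) {..<N}) (\<Pi>\<^sub>M i\<in>{..<N}. borel)"

definition lborel_vec :: "nat \<Rightarrow> real vec measure" where
  "lborel_vec N = distr (\<Pi>\<^sub>M i\<in>{..<N}. lborel) (borel_vec N) (vec N)"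

definition unit_sphere :: "nat \<Rightarrow> real vec set" where
  "unit_sphere N = {v \<in> carrier_vec N. l2_norm v = 1}"

definition punctured_ball :: "nat \<Rightarrow> real vec set" where
  "punctured_ball N = {v \<in> carrier_vec N. 0 < l2_norm v \<and> l2_norm v \<le> 1}"

text \<open>
  The uniform (rotation invariant) distribution on the sphere as normalized cone measure:
  the radial projection of the uniform distribution on the unit ball with the null set \<open>{0}\<close>
  removed.
\<close>

definition uniform_sphere :: "nat \<Rightarrow> real vec measure" where
  "uniform_sphere N =
     distr
       (uniform_measure (restrict_space (lborel_vec N) (punctured_ball N)) (punctured_ball N))
       (restrict_space (borel_vec N) (unit_sphere N))
       (\<lambda>v. (1 / l2_norm v) \<cdot>\<^sub>v v)"

text \<open>
  A sample point \<open>\<omega> :: nat \<Rightarrow> real vec\<close> lists the answers to all potential calls; infinitely many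
  are provided because the number of calls that are actually made is random.
\<close>

definition random_oracle :: "nat \<Rightarrow> (nat \<Rightarrow> real vec) measure" where
  "random_oracle N = (\<Pi>\<^sub>M i\<in>(UNIV :: nat set). uniform_sphere N)"

lemma space_borel_vec [simp]: "space (borel_vec N) = carrier_vec N"
  by (simp add: borel_vec_def)

lemma space_lborel_vec [simp]: "space (lborel_vec N) = carrier_vec N"
  and sets_lborel_vec [simp]: "sets (lborel_vec N) = sets (borel_vec N)"
  by (simp_all add: lborel_vec_def)

lemma measurable_vec_index:
  assumes "i < N"
  shows "(\<lambda>v. v $ i) \<in> borel_measurable (borel_vec N)"
proof -
  have "(\<lambda>v. restrict (vec_index v) {..<N} i) \<in> borel_measurable (borel_vec N)"
  proof (rule measurable_compose[of _ _ "\<Pi>\<^sub>M i\<in>{..<N}. borel"])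
    show "(\<lambda>v. restrict (vec_index v) {..<N}) \<in> borel_vec N \<rightarrow>\<^sub>M (\<Pi>\<^sub>M i\<in>{..<N}. borel)"
      unfolding borel_vec_def by (rule measurable_vimage_algebra1) (auto simp: space_PiM)
    show "(\<lambda>x. x i) \<in> borel_measurable (\<Pi>\<^sub>M i\<in>{..<N}. (borel :: real measure))"
      by (rule measurable_component_singleton) (use assms in simp)
  qed
  thus ?thesis using assms by simp
qed

lemma measurable_into_borel_vec:
  assumes "\<And>x. x \<in> space M \<Longrightarrow> f x \<in> carrier_vec N"
    and "\<And>i. i < N \<Longrightarrow> (\<lambda>x. f x $ i) \<in> borel_measurable M"
  shows "f \<in> M \<rightarrow>\<^sub>M borel_vec N"
  unfolding borel_vec_def
proof (rule measurable_vimage_algebra2)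
  show "f \<in> space M \<rightarrow> carrier_vec N" using assms(1) by auto
  show "(\<lambda>x. restrict (vec_index (f x)) {..<N}) \<in> M \<rightarrow>\<^sub>M (\<Pi>\<^sub>M i\<in>{..<N}. borel)"
    using assms(2) by (intro measurable_restrict) auto
qed

lemma l2_norm_alt:
  assumes "v \<in> carrier_vec N"
  shows "l2_norm v = sqrt (\<Sum>i<N. (v $ i)\<^sup>2)"
  using assms by (simp add: l2_norm_def scalar_prod_def power2_eq_square atLeast0LessThan)

lemma measurable_l2_norm [measurable]: "l2_norm \<in> borel_measurable (borel_vec N)"
proof -
  have "(\<lambda>v. sqrt (\<Sum>i<N. (v $ i)\<^sup>2)) \<in> borel_measurable (borel_vec N)"
    by (intro measurable_compose[OF _ borel_measurable_sqrt] borel_measurable_sum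
        borel_measurable_power measurable_vec_index) simp
  thus ?thesis
    by (rule measurable_cong[THEN iffD1, rotated]) (simp add: l2_norm_alt)
qed

lemma measurable_vec: "vec N \<in> (\<Pi>\<^sub>M i\<in>{..<N}. lborel) \<rightarrow>\<^sub>M borel_vec N"
  by (rule measurable_into_borel_vec) auto

lemma sets_punctured_ball: "punctured_ball N \<in> sets (borel_vec N)"
proof -
  have "{v \<in> space (borel_vec N). 0 < l2_norm v \<and> l2_norm v \<le> 1} \<in> sets (borel_vec N)"
    by measurable
  thus ?thesis by (simp add: punctured_ball_def)
qed

lemma emeasure_punctured_ball:
  assumes "N > 0"
  shows "emeasure (lborel_vec N) (punctured_ball N) \<noteq> 0"
    and "emeasure (lborel_vec N) (punctured_ball N) \<noteq> \<infinity>"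
proof -
  interpret product_sigma_finite "\<lambda>_ :: nat. lborel :: real measure"
    by standard
  let ?L = "\<Pi>\<^sub>M i\<in>{..<N}. (lborel :: real measure)"
  let ?V = "vec N -` punctured_ball N \<inter> space ?L"
  have eq: "emeasure (lborel_vec N) (punctured_ball N) = emeasure ?L ?V"
    unfolding lborel_vec_def by (rule emeasure_distr[OF measurable_vec sets_punctured_ball])
  have V: "?V \<in> sets ?L"
    by (rule measurable_sets[OF measurable_vec sets_punctured_ball])
  have norm: "l2_norm (vec N x) = sqrt (\<Sum>i<N. (x i)\<^sup>2)" for x
    by (subst l2_norm_alt[of _ N]) auto
  have "(\<Pi>\<^sub>E i\<in>{..<N}. {1 / (2 * real N)..1 / real N}) \<subseteq> ?V"
  proof
    fix x assume x: "x \<in> (\<Pi>\<^sub>E i\<in>{..<N}. {1 / (2 * real N)..1 / real N})"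
    have lo: "0 < x i" and hi: "x i \<le> 1 / real N" if "i < N" for i
    proof -
      have "1 / (2 * real N) \<le> x i" "x i \<le> 1 / real N" using x that by (auto simp: PiE_iff)
      moreover have "1 / (2 * real N) > 0" using assms by simp
      ultimately show "0 < x i" "x i \<le> 1 / real N" by linarith+
    qed
    have "(\<Sum>i<N. (x i)\<^sup>2) > 0"
    proof (rule sum_pos)
      show "{..<N} \<noteq> {}" using assms by auto
      show "0 < (x i)\<^sup>2" if "i \<in> {..<N}" for i
        using lo[of i] that by (simp add: zero_less_power)
    qed simp
    moreover have "(\<Sum>i<N. (x i)\<^sup>2) \<le> 1"
    proof -
      have "(\<Sum>i<N. (x i)\<^sup>2) \<le> (\<Sum>i<N. 1 / real N)"
      proof (rule sum_mono)
        fix i assume "i \<in> {..<N}"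
        hence i: "i < N" by simp
        have "1 / real N \<le> 1" using assms by simp
        hence "x i \<le> 1" using hi[OF i] by linarith
        hence "(x i)\<^sup>2 \<le> x i" using lo[OF i] by (simp add: power2_eq_square mult_left_le)
        thus "(x i)\<^sup>2 \<le> 1 / real N" using hi[OF i] by linarith
      qed
      also have "\<dots> = 1" using assms by simp
      finally show ?thesis .
    qed
    ultimately show "x \<in> ?V"
      using x by (auto simp: punctured_ball_def norm space_PiM PiE_iff)
  qed
  hence "emeasure ?L (\<Pi>\<^sub>E i\<in>{..<N}. {1 / (2 * real N)..1 / real N}) \<le> emeasure ?L ?V"
    by (rule emeasure_mono[OF _ V])
  moreover have "emeasure ?L (\<Pi>\<^sub>E i\<in>{..<N}. {1 / (2 * real N)..1 / real N}) \<noteq> 0"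
    using assms by (subst emeasure_PiM) (auto simp: field_simps)
  ultimately show "emeasure (lborel_vec N) (punctured_ball N) \<noteq> 0"
    using eq by auto
  have "?V \<subseteq> (\<Pi>\<^sub>E i\<in>{..<N}. {-1..1})"
  proof
    fix x assume x: "x \<in> ?V"
    hence le: "(\<Sum>i<N. (x i)\<^sup>2) \<le> 1" by (auto simp: punctured_ball_def norm)
    have "-1 \<le> x i \<and> x i \<le> 1" if "i < N" for i
    proof -
      have "(x i)\<^sup>2 \<le> (\<Sum>i<N. (x i)\<^sup>2)"
        by (rule member_le_sum) (use that in auto)
      hence "(x i)\<^sup>2 \<le> 1" using le by linarith
      thus ?thesis by (simp add: abs_square_le_1 abs_le_iff)
    qed
    thus "x \<in> (\<Pi>\<^sub>E i\<in>{..<N}. {-1..1})" using x by (auto simp: space_PiM PiE_iff)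
  qed
  hence "emeasure ?L ?V \<le> emeasure ?L (\<Pi>\<^sub>E i\<in>{..<N}. {-1..1})"
    by (intro emeasure_mono sets_PiM_I_finite) auto
  also have "\<dots> < \<infinity>"
    by (subst emeasure_PiM) (simp_all add: ennreal_power less_top[symmetric] power_eq_top_ennreal)
  finally show "emeasure (lborel_vec N) (punctured_ball N) \<noteq> \<infinity>"
    using eq by auto
qed

lemma space_uniform_sphere [simp]: "space (uniform_sphere N) = unit_sphere N"
  by (auto simp: uniform_sphere_def space_restrict_space unit_sphere_def)

lemma prob_space_uniform_sphere:
  assumes "N > 0"
  shows "prob_space (uniform_sphere N)"
proof -
  let ?B = "punctured_ball N"
  let ?R = "restrict_space (lborel_vec N) ?B"
  have sub: "?B \<subseteq> carrier_vec N" by (auto simp: punctured_ball_def)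
  have em: "emeasure ?R ?B = emeasure (lborel_vec N) ?B"
    using sets_punctured_ball sub
    by (subst emeasure_restrict_space) (auto simp: sets.Int_space_eq2 Int_absorb2)
  interpret prob_space "uniform_measure ?R ?B"
    using emeasure_punctured_ball[OF assms]
    by (intro prob_space_uniform_measure) (simp_all add: em)
  have nz: "l2_norm v > 0" if "v \<in> ?B" for v using that by (simp add: punctured_ball_def)
  have normalized: "l2_norm ((1 / l2_norm v) \<cdot>\<^sub>v v) = 1" if v: "v \<in> ?B" for v
  proof -
    have c: "v \<in> carrier_vec N" using v sub by auto
    have "l2_norm ((1 / l2_norm v) \<cdot>\<^sub>v v) = sqrt ((1 / l2_norm v)\<^sup>2 * (v \<bullet> v))"
      using c by (simp add: l2_norm_def power2_eq_square)
    also have "\<dots> = (1 / l2_norm v) * l2_norm v"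
      using nz[OF v] by (simp add: real_sqrt_mult l2_norm_def)
    finally show ?thesis using nz[OF v] by simp
  qed
  have sp: "space (uniform_measure ?R ?B) = ?B"
    using sub by (auto simp: space_restrict_space)
  show ?thesis
    unfolding uniform_sphere_def
  proof (rule prob_space_distr, rule measurable_restrict_space2)
    show "(\<lambda>v. (1 / l2_norm v) \<cdot>\<^sub>v v) \<in> space (uniform_measure ?R ?B) \<rightarrow> unit_sphere N"
      unfolding sp using normalized sub by (auto simp: unit_sphere_def)
    show "(\<lambda>v. (1 / l2_norm v) \<cdot>\<^sub>v v) \<in> uniform_measure ?R ?B \<rightarrow>\<^sub>M borel_vec N"
    proof (rule measurable_into_borel_vec)
      show "(1 / l2_norm x) \<cdot>\<^sub>v x \<in> carrier_vec N" if "x \<in> space (uniform_measure ?R ?B)" for x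
        using that sub unfolding sp by auto
      fix i assume i: "i < N"
      have [measurable]: "(\<lambda>v. v $ i) \<in> borel_measurable (borel_vec N)"
        by (rule measurable_vec_index[OF i])
      have "(\<lambda>v. (1 / l2_norm v) * v $ i) \<in> borel_measurable (borel_vec N)"
        by measurable
      hence "(\<lambda>v. (1 / l2_norm v) * v $ i) \<in> borel_measurable (lborel_vec N)"
        by (simp cong: measurable_cong_sets)
      hence "(\<lambda>v. (1 / l2_norm v) * v $ i) \<in> borel_measurable ?R"
        by (rule measurable_restrict_space1)
      moreover have "((1 / l2_norm v) \<cdot>\<^sub>v v) $ i = (1 / l2_norm v) * v $ i"
        if "v \<in> space ?R" for v
        using that i sub by (auto simp: space_restrict_space)
      ultimately have "(\<lambda>v. ((1 / l2_norm v) \<cdot>\<^sub>v v) $ i) \<in> borel_measurable ?R"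
        by (subst measurable_cong)
      moreover have "borel_measurable (uniform_measure ?R ?B) = borel_measurable ?R"
        by (rule measurable_cong_sets[OF sets_uniform_measure refl])
      ultimately show "(\<lambda>v. ((1 / l2_norm v) \<cdot>\<^sub>v v) $ i)
          \<in> borel_measurable (uniform_measure ?R ?B)"
        by blast
    qed
  qed
qed

lemma prob_space_random_oracle:
  assumes "N > 0"
  shows "prob_space (random_oracle N)"
  unfolding random_oracle_def by (intro prob_space_PiM prob_space_uniform_sphere assms)

text \<open>
  The last argument counts the multiplications by \<open>G\<close> performed so far; the result is
  the final estimate and this count.
\<close>

fun power_iteration_loop ::
  "real mat \<Rightarrow> nat \<Rightarrow> real vec \<Rightarrow> real \<Rightarrow> nat \<Rightarrow> real \<times> nat" where
  "power_iteration_loop G 0 v lam c = (lam, c)"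
| "power_iteration_loop G (Suc r) v lam c =
     (let b = (1 / l2_norm v) \<cdot>\<^sub>v v;
          v' = G *\<^sub>v b
      in power_iteration_loop G r v' ((v' \<bullet> b) / (b \<bullet> b)) (c + 1))"

text \<open>
  The loop body runs for \<open>j = 0, \<dots>, k\<close>, hence \<open>k + 1\<close> times; the initial estimate \<open>0\<close> is always
  overwritten.
\<close>

definition power_iteration :: "real mat \<Rightarrow> real vec \<Rightarrow> nat \<Rightarrow> real \<times> nat" where
  "power_iteration G b k = power_iteration_loop G (Suc k) b 0 0"

datatype verdict = Positive_Definite | Not_Positive_Definite | Stopped_Singular

record outcome =
  answer :: verdict
  num_for :: nat
  num_inv :: nat

text \<open>
  The arguments \<open>r\<close> and \<open>c\<close> are the number of iterations left and the number of multiplications by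
  shifted inverses so far. Since \<open>(\<mu> - 1) I + A / mhat = (A + mhat (\<mu> - 1) I) / mhat\<close>, a
  multiplication by \<open>Z\<close> is one multiplication by a shifted inverse of \<open>A\<close>. Oracle calls \<open>0\<close> and
  \<open>1\<close> are used up before the loop.
\<close>

fun solver_loop ::
  "real mat \<Rightarrow> (nat \<Rightarrow> real vec) \<Rightarrow> real \<Rightarrow> nat \<Rightarrow> nat \<Rightarrow> nat \<Rightarrow> nat \<Rightarrow> verdict \<times> nat" where
  "solver_loop A \<omega> mhat k 0 j c = (Positive_Definite, c)"
| "solver_loop A \<omega> mhat k (Suc r) j c =
     (let \<mu> = 1 + 1 / 2 ^ j;
          M = (\<mu> - 1) \<cdot>\<^sub>m 1\<^sub>m (dim_row A) + (1 / mhat) \<cdot>\<^sub>m A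
      in if \<not> invertible_mat M then (Stopped_Singular, c)
         else let Z = (\<mu> - 1) \<cdot>\<^sub>m inverse_mat M;
                  (lam, n) = power_iteration Z (\<omega> (2 + j)) k
              in if lam \<ge> 1 then (Not_Positive_Definite, c + n)
                 else solver_loop A \<omega> mhat k r (Suc j) (c + n))"

definition solver :: "real mat \<Rightarrow> (nat \<Rightarrow> real vec) \<Rightarrow> outcome" where
  "solver A \<omega> =
     (let N = dim_row A;
          k = nat \<lceil>2.9 * log 10 (real N) + 54.1\<rceil>;
          (lam_inv, n_inv) = power_iteration (inverse_mat A ^\<^sub>m 2) (\<omega> 0) k;
          (lam_for, n_for) = power_iteration (A ^\<^sub>m 2) (\<omega> 1) k;
          mcheck = sqrt (0.5 / lam_inv);
          mhat = sqrt (1.5 * lam_for);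
          J = \<lceil>log 2 (mhat / mcheck)\<rceil>;
          k' = (if J \<ge> 1
                then nat \<lceil>2.9 * log 10 (real N) + 1.8 * log 2 (real_of_int J) + 40.3\<rceil>
                else k);
          (ans, n_shift) = solver_loop A \<omega> mhat k' (nat J) 0 0
      in \<lparr>answer = ans, num_for = 2 * n_for, num_inv = 2 * n_inv + n_shift\<rparr>)"

end

(* The bound holds for every sample point. The estimates of a power iteration on A^2 or A^{-2} are
   Rayleigh quotients, hence at most |A|^2 or |A^{-1}|^2, whatever the starting vector. So
   mhat / mcheck <= sqrt 3 * kappa, which gives J = O(log kappa) and
   k' = O(log N + log log kappa). *)
theory Submission
  imports Defs
begin

section \<open>The Euclidean norm on vectors of variable dimension\<close>

lemma l2_norm_smult:
  assumes "v \<in> carrier_vec N"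
  shows "l2_norm (c \<cdot>\<^sub>v v) = \<bar>c\<bar> * l2_norm v"
  using assms by (simp add: l2_norm_def real_sqrt_mult mult.assoc[symmetric])

lemma scalar_prod_self_nonneg: "0 \<le> v \<bullet> (v :: real vec)"
  by (simp add: scalar_prod_def sum_nonneg)

lemma l2_norm_nonneg: "0 \<le> l2_norm v"
  by (simp add: l2_norm_def scalar_prod_self_nonneg)

lemma l2_norm_power2: "(l2_norm v)\<^sup>2 = v \<bullet> v"
  by (simp add: l2_norm_def scalar_prod_self_nonneg)

lemma l2_norm_eq_0:
  assumes "v \<in> carrier_vec N" "l2_norm v = 0"
  shows "v = 0\<^sub>v N"
proof
  have "(\<Sum>i<N. (v $ i)\<^sup>2) = 0"
    using assms by (simp add: l2_norm_alt)
  thus "v $ i = 0\<^sub>v N $ i" if "i < dim_vec (0\<^sub>v N)" for i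
    using that by (simp add: sum_nonneg_eq_0_iff)
qed (use assms in auto)

lemma abs_index_le_l2_norm:
  assumes "v \<in> carrier_vec N" "i < N"
  shows "\<bar>v $ i\<bar> \<le> l2_norm v"
proof -
  have "(v $ i)\<^sup>2 \<le> (\<Sum>i<N. (v $ i)\<^sup>2)"
    by (rule member_le_sum) (use assms in auto)
  hence "sqrt ((v $ i)\<^sup>2) \<le> sqrt (\<Sum>i<N. (v $ i)\<^sup>2)"
    by (rule real_sqrt_le_mono)
  thus ?thesis using assms by (simp add: l2_norm_alt)
qed

lemma l2_norm_le_sum_abs:
  assumes "v \<in> carrier_vec N"
  shows "l2_norm v \<le> (\<Sum>i<N. \<bar>v $ i\<bar>)"
  using L2_set_le_sum_abs[of "\<lambda>i. v $ i" "{..<N}"] assms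
  by (simp add: l2_norm_alt L2_set_def)

section \<open>The spectral norm as an operator norm\<close>

text \<open>A real \<open>SUP\<close> dominates its members only if the set is bounded. Coordinates
  of a unit vector are at most 1 in absolute value, so the sum of all
  \<open>\<bar>B $$ (i, j)\<bar>\<close> is a bound.\<close>

lemma bdd_above_l2_norm_mult:
  assumes "B \<in> carrier_mat N N"
  shows "bdd_above ((\<lambda>v. l2_norm (B *\<^sub>v v)) ` {v \<in> carrier_vec N. l2_norm v = 1})"
proof (rule bdd_aboveI2)
  fix v assume "v \<in> {v \<in> carrier_vec N. l2_norm v = 1}"
  hence v: "v \<in> carrier_vec N" "l2_norm v = 1" by auto
  have "l2_norm (B *\<^sub>v v) \<le> (\<Sum>i<N. \<bar>(B *\<^sub>v v) $ i\<bar>)"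
    by (rule l2_norm_le_sum_abs) (use assms v in auto)
  also have "\<dots> \<le> (\<Sum>i<N. \<Sum>j<N. \<bar>B $$ (i, j)\<bar>)"
  proof (rule sum_mono)
    fix i assume i: "i \<in> {..<N}"
    have "\<bar>(B *\<^sub>v v) $ i\<bar> = \<bar>\<Sum>j<N. B $$ (i, j) * v $ j\<bar>"
      using i assms v by (auto simp: scalar_prod_def atLeast0LessThan)
    also have "\<dots> \<le> (\<Sum>j<N. \<bar>B $$ (i, j) * v $ j\<bar>)"
      by (rule sum_abs)
    also have "\<dots> \<le> (\<Sum>j<N. \<bar>B $$ (i, j)\<bar>)"
      using abs_index_le_l2_norm[OF v(1)] v(2)
      by (intro sum_mono) (simp add: abs_mult mult_left_le)
    finally show "\<bar>(B *\<^sub>v v) $ i\<bar> \<le> (\<Sum>j<N. \<bar>B $$ (i, j)\<bar>)" .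
  qed
  finally show "l2_norm (B *\<^sub>v v) \<le> (\<Sum>i<N. \<Sum>j<N. \<bar>B $$ (i, j)\<bar>)" .
qed

lemma l2_norm_mult_unit_le:
  assumes "B \<in> carrier_mat N N" "v \<in> carrier_vec N" "l2_norm v = 1"
  shows "l2_norm (B *\<^sub>v v) \<le> spectral_norm B"
  unfolding spectral_norm_def using assms bdd_above_l2_norm_mult[OF assms(1)]
  by (intro cSUP_upper) auto

text \<open>For \<open>N > 0\<close> the unit sphere contains \<open>unit_vec N 0\<close>, so the
  supremum dominates a nonnegative value.\<close>

lemma spectral_norm_nonneg:
  assumes "B \<in> carrier_mat N N" "N > 0"
  shows "0 \<le> spectral_norm B"
proof -
  have "l2_norm (unit_vec N 0) = 1"
    using assms by (simp add: l2_norm_def)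
  hence "l2_norm (B *\<^sub>v unit_vec N 0) \<le> spectral_norm B"
    using assms by (intro l2_norm_mult_unit_le) auto
  thus ?thesis using l2_norm_nonneg order_trans by blast
qed

lemma l2_norm_mult_le:
  assumes "B \<in> carrier_mat N N" "v \<in> carrier_vec N"
  shows "l2_norm (B *\<^sub>v v) \<le> spectral_norm B * l2_norm v"
proof (cases "l2_norm v = 0")
  case True
  hence "v = 0\<^sub>v N" using assms l2_norm_eq_0 by blast
  hence "B *\<^sub>v v = 0\<^sub>v N" using assms by auto
  thus ?thesis using True by (simp add: l2_norm_def)
next
  case False
  hence pos: "l2_norm v > 0" using l2_norm_nonneg[of v] by linarith
  let ?u = "(1 / l2_norm v) \<cdot>\<^sub>v v"
  have "l2_norm ?u = 1" using pos assms by (simp add: l2_norm_smult)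
  hence "l2_norm (B *\<^sub>v ?u) \<le> spectral_norm B"
    using assms by (intro l2_norm_mult_unit_le) auto
  moreover have "B *\<^sub>v ?u = (1 / l2_norm v) \<cdot>\<^sub>v (B *\<^sub>v v)"
    using assms by (simp add: mult_mat_vec)
  ultimately show ?thesis
    using pos assms by (simp add: l2_norm_smult[of _ N] divide_le_eq)
qed

section \<open>Rayleigh quotients and the estimates of power iterations\<close>

text \<open>Symmetry moves one factor \<open>B\<close> across the scalar product, which turns the
  quotient into the square of \<open>l2_norm (B *\<^sub>v b) / l2_norm b\<close>.\<close>

lemma rayleigh_quotient_square_bounds:
  assumes B: "B \<in> carrier_mat N N" and sym: "symmetric_mat B" and b: "b \<in> carrier_vec N"
  shows "0 \<le> ((B ^\<^sub>m 2) *\<^sub>v b) \<bullet> b / (b \<bullet> b)"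
    and "((B ^\<^sub>m 2) *\<^sub>v b) \<bullet> b / (b \<bullet> b) \<le> (spectral_norm B)\<^sup>2"
proof -
  have "B ^\<^sub>m 2 = B * B" using B by (simp add: numeral_2_eq_2)
  hence "((B ^\<^sub>m 2) *\<^sub>v b) \<bullet> b = (B *\<^sub>v (B *\<^sub>v b)) \<bullet> b"
    using B b by (simp add: assoc_mult_mat_vec)
  also have "\<dots> = (B *\<^sub>v b) \<bullet> (transpose_mat B *\<^sub>v b)"
    using transpose_vec_mult_scalar[OF B mult_mat_vec_carrier[OF B b] b]
      comm_scalar_prod[of b N "B *\<^sub>v (B *\<^sub>v b)"]
      comm_scalar_prod[of "transpose_mat B *\<^sub>v b" N "B *\<^sub>v b"] B b by auto
  also have "\<dots> = (l2_norm (B *\<^sub>v b))\<^sup>2"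
    using sym by (simp add: symmetric_mat_def l2_norm_power2)
  finally have eq: "((B ^\<^sub>m 2) *\<^sub>v b) \<bullet> b / (b \<bullet> b) = (l2_norm (B *\<^sub>v b))\<^sup>2 / (l2_norm b)\<^sup>2"
    by (simp add: l2_norm_power2)
  show "0 \<le> ((B ^\<^sub>m 2) *\<^sub>v b) \<bullet> b / (b \<bullet> b)" unfolding eq by simp
  have "(l2_norm (B *\<^sub>v b))\<^sup>2 \<le> (spectral_norm B * l2_norm b)\<^sup>2"
    by (rule power_mono[OF l2_norm_mult_le[OF B b] l2_norm_nonneg])
  thus "((B ^\<^sub>m 2) *\<^sub>v b) \<bullet> b / (b \<bullet> b) \<le> (spectral_norm B)\<^sup>2"
    \<comment> \<open>If \<open>b\<close> has norm 0, the quotient is 0 because division by zero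
      yields 0.\<close>
    unfolding eq by (cases "l2_norm b = 0") (simp_all add: power_mult_distrib divide_le_eq)
qed

text \<open>Membership of the current estimate in \<open>{0..t}\<close> is a loop invariant: each
  pass replaces it by a Rayleigh quotient, whatever the iterate.\<close>

lemma power_iteration_loop_bounds:
  assumes "G \<in> carrier_mat N N"
    and "\<And>b. b \<in> carrier_vec N \<Longrightarrow> (G *\<^sub>v b) \<bullet> b / (b \<bullet> b) \<in> {0..t}"
    and "v \<in> carrier_vec N" "lam \<in> {0..t}"
  shows "fst (power_iteration_loop G r v lam c) \<in> {0..t}"
  using assms(3,4)
proof (induction r arbitrary: v lam c)
  case (Suc r)
  let ?b = "(1 / l2_norm v) \<cdot>\<^sub>v v"
  have b: "?b \<in> carrier_vec N" using Suc.prems by simp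
  show ?case
    unfolding power_iteration_loop.simps Let_def
    by (rule Suc.IH[OF mult_mat_vec_carrier[OF assms(1) b] assms(2)[OF b]])
qed simp

lemma power_iteration_square_bounds:
  assumes B: "B \<in> carrier_mat N N" and "symmetric_mat B" and "v \<in> carrier_vec N"
  shows "fst (power_iteration (B ^\<^sub>m 2) v k) \<in> {0..(spectral_norm B)\<^sup>2}"
  unfolding power_iteration_def
  using rayleigh_quotient_square_bounds[OF assms(1,2)] assms
  by (intro power_iteration_loop_bounds[where N = N]) auto

section \<open>Counting multiplications\<close>

lemma snd_power_iteration_loop: "snd (power_iteration_loop G r v lam c) = c + r"
  by (induction r arbitrary: v lam c) (simp_all add: Let_def)

lemma snd_power_iteration: "snd (power_iteration G b k) = k + 1"
  by (simp add: power_iteration_def snd_power_iteration_loop del: power_iteration_loop.simps)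

text \<open>A pass costs \<open>k + 1\<close> multiplications, or none if it meets a singular
  matrix. Either early exit only saves the remaining passes.\<close>

lemma snd_solver_loop_le: "snd (solver_loop A \<omega> m k r j c) \<le> c + r * (k + 1)"
proof (induction r arbitrary: j c)
  case (Suc r)
  let ?c = "c + (k + 1)"
  have "snd (solver_loop A \<omega> m k r (Suc j) ?c) \<le> ?c + r * (k + 1)" by (rule Suc.IH)
  thus ?case
    by (auto simp: Let_def case_prod_beta snd_power_iteration)
qed simp

section \<open>The inverse of a symmetric matrix\<close>

text \<open>Since \<open>inverse_mat\<close> is taken with \<open>the\<close>,
  \<open>mat_inverse A\<close> must be shown to be some matrix. The library rules out
  \<open>None\<close> for units of the matrix ring, so \<open>A\<close> is first shown to be a
  unit.\<close>

lemma inverse_mat_props: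
  assumes A: "A \<in> carrier_mat N N" and inv: "invertible_mat A"
  shows "inverse_mat A \<in> carrier_mat N N"
    and "A * inverse_mat A = 1\<^sub>m N" and "inverse_mat A * A = 1\<^sub>m N"
proof -
  obtain B where B: "inverts_mat A B" "inverts_mat B A"
    using inv by (auto simp: invertible_mat_def)
  hence AB: "A * B = 1\<^sub>m N" and BA: "B * A = 1\<^sub>m (dim_row B)"
    using A by (auto simp: inverts_mat_def)
  \<comment> \<open>\<open>invertible_mat\<close> does not state the dimensions of \<open>B\<close>;
    the two product equations determine them.\<close>
  have "dim_col B = N" using arg_cong[OF AB, of dim_col] by simp
  moreover have "dim_row B = N" using arg_cong[OF BA, of dim_col] A by simp
  ultimately have Bc: "B \<in> carrier_mat N N" by auto
  have "A \<in> Units (ring_mat TYPE(real) N ())"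
    using A Bc AB BA unfolding Units_def by (auto simp: ring_mat_simps)
  then obtain C where "mat_inverse A = Some C"
    using mat_inverse(1)[OF A, where b = "()"] by (cases "mat_inverse A") auto
  thus "inverse_mat A \<in> carrier_mat N N"
    "A * inverse_mat A = 1\<^sub>m N" "inverse_mat A * A = 1\<^sub>m N"
    using mat_inverse(2)[OF A, of C] by (auto simp: inverse_mat_def)
qed

text \<open>Transposing \<open>A * inverse_mat A = 1\<^sub>m N\<close> makes the transposed inverse
  a left inverse of \<open>A\<close>; a left inverse coincides with a right inverse.\<close>

lemma symmetric_inverse_mat:
  assumes A: "A \<in> carrier_mat N N" and sym: "symmetric_mat A" and inv: "invertible_mat A"
  shows "symmetric_mat (inverse_mat A)"
proof -
  note B = inverse_mat_props[OF A inv]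
  let ?B = "inverse_mat A"
  have TA: "transpose_mat ?B * A = 1\<^sub>m N"
    using transpose_mult[OF A B(1)] sym B(2) by (simp add: symmetric_mat_def)
  have "transpose_mat ?B = transpose_mat ?B * (A * ?B)"
    using B by simp
  also have "\<dots> = (transpose_mat ?B * A) * ?B"
    by (rule assoc_mult_mat[symmetric]) (use A B in auto)
  also have "\<dots> = ?B" using TA B by simp
  finally show ?thesis by (simp add: symmetric_mat_def)
qed

lemma oracle_carrier:
  assumes "\<omega> \<in> space (random_oracle N)"
  shows "\<omega> i \<in> carrier_vec N"
  using assms by (auto simp: random_oracle_def space_PiM unit_sphere_def PiE_iff)

section \<open>Elementary estimates of logarithms\<close>

lemma log10_le_ln: "x \<ge> 1 \<Longrightarrow> log 10 x \<le> ln (x :: real)"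
proof -
  assume x: "x \<ge> 1"
  have "ln 10 \<ge> (1 :: real)" using exp_le by (subst ln_ge_iff) simp_all
  thus ?thesis using x mult_left_mono[of 1 "ln 10" "ln x"] by (simp add: log_def divide_le_eq)
qed

lemma log2_le_ln: "x \<ge> 1 \<Longrightarrow> log 2 x \<le> 3 / 2 * ln (x :: real)"
proof -
  assume x: "x \<ge> 1"
  have "ln x * (2 / 3) \<le> ln x * ln 2"
    using x ln2_ge_two_thirds by (intro mult_left_mono) auto
  thus ?thesis by (simp add: log_def divide_le_eq)
qed

lemma real_nat_ceiling_le: "x \<ge> 0 \<Longrightarrow> real (nat \<lceil>x\<rceil>) \<le> x + 1"
  by linarith

lemma one_le_ln_real:
  assumes "N \<ge> (3 :: nat)"
  shows "1 \<le> ln (real N)"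
  using assms exp_le by (subst ln_ge_iff) simp_all

section \<open>Bounds on the two counts\<close>

lemma num_for_solver_le:
  assumes A: "A \<in> carrier_mat N N" and N: "N \<ge> 3"
  shows "real (num_for (solver A \<omega>)) \<le> 118 * ln (real N)"
proof -
  let ?x = "2.9 * log 10 (real N) + 54.1"
  have "num_for (solver A \<omega>) = 2 * (nat \<lceil>?x\<rceil> + 1)"
    using A by (simp add: solver_def Let_def case_prod_beta snd_power_iteration)
  moreover have "real (nat \<lceil>?x\<rceil>) \<le> ?x + 1"
    using N by (intro real_nat_ceiling_le) simp
  \<comment> \<open>With \<open>ln (real N)\<close> at least 1, twice
    \<open>2.9 + 54.1 + 1 + 1\<close> gives 118; the two units come from the ceiling and from the
    \<open>k + 1\<close> passes.\<close>
  ultimately show ?thesis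
    using log10_le_ln[of "real N"] one_le_ln_real[OF N] N by simp
qed

text \<open>The left side is \<open>mhat / mcheck\<close> for estimates \<open>x\<close> of
  \<open>A ^\<^sub>m 2\<close> and \<open>y\<close> of \<open>inverse_mat A ^\<^sub>m 2\<close>. It
  equals \<open>sqrt (3 * (x * y))\<close> for nonzero \<open>y\<close>, and 3 is rounded up to 4.
  For \<open>y = 0\<close> it is 0, by division by zero.\<close>

lemma sqrt_quotient_le:
  fixes x y a b :: real
  assumes "x \<in> {0..a\<^sup>2}" "y \<in> {0..b\<^sup>2}" "a \<ge> 0" "b \<ge> 0"
  shows "sqrt (1.5 * x) / sqrt (0.5 / y) \<le> 2 * (a * b)"
proof (cases "y = 0")
  case False
  hence "sqrt (1.5 * x) / sqrt (0.5 / y) = sqrt (3 * (x * y))"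
    by (simp add: real_sqrt_divide[symmetric])
  also have "\<dots> \<le> sqrt ((2 * (a * b))\<^sup>2)"
  proof (rule real_sqrt_le_mono)
    have "x * y \<le> a\<^sup>2 * b\<^sup>2" using assms by (intro mult_mono) auto
    moreover have "0 \<le> x * y" using assms by simp
    ultimately show "3 * (x * y) \<le> (2 * (a * b))\<^sup>2"
      by (simp add: power_mult_distrib)
  qed
  also have "\<dots> = 2 * (a * b)" using assms by (intro real_sqrt_abs[THEN trans]) simp
  finally show ?thesis .
qed (use assms in simp)

text \<open>The case \<open>x = 0\<close> is that of a vanishing estimate, where \<open>log 2 0 = 0\<close>.\<close>

lemma ceiling_log2_le:
  fixes x \<kappa> :: real
  assumes "0 \<le> x" "x \<le> 2 * \<kappa>" "4 \<le> ln \<kappa>" "0 < \<kappa>"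
  shows "real_of_int \<lceil>log 2 x\<rceil> \<le> 2 * ln \<kappa>"
proof -
  have "1 \<le> \<kappa>" using ln_le_minus_one[of \<kappa>] assms by linarith
  show ?thesis
  proof (cases "x = 0")
    case False
    have "log 2 x \<le> log 2 (2 * \<kappa>)" using assms False by simp
    also have "\<dots> = 1 + log 2 \<kappa>" using assms by (simp add: log_mult)
    also have "\<dots> \<le> 1 + 3 / 2 * ln \<kappa>" using log2_le_ln[OF \<open>1 \<le> \<kappa>\<close>] by simp
    \<comment> \<open>The ceiling adds at most 1, and \<open>2 + 3 / 2 * ln \<kappa>\<close> is at
      most \<open>2 * ln \<kappa>\<close> exactly when \<open>ln \<kappa>\<close> is at least
      4.\<close>
    finally show ?thesis using assms by linarith
  qed (use assms \<open>1 \<le> \<kappa>\<close> in \<open>simp add: log_def\<close>)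
qed

lemma num_inv_solver_le:
  assumes A: "A \<in> carrier_mat N N" and sym: "symmetric_mat A" and inv: "invertible_mat A"
    and N: "N \<ge> 3" and cond: "condition_number A \<ge> exp 4"
    and \<omega>: "\<omega> \<in> space (random_oracle N)"
  shows "real (num_inv (solver A \<omega>)) \<le>
    250 * ln (real N) * (ln (condition_number A))\<^sup>2 * ln (ln (1 + condition_number A))"
proof -
  define \<kappa> where "\<kappa> = condition_number A"
  define n where "n = ln (real N)"
  define L where "L = ln \<kappa>"
  define LL where "LL = ln (ln (1 + \<kappa>))"
  define k where "k = nat \<lceil>2.9 * log 10 (real N) + 54.1\<rceil>"
  \<comment> \<open>\<open>li\<close>, \<open>lf\<close> and \<open>mh\<close> stand for the values
    \<open>lam_inv\<close>, \<open>lam_for\<close> and \<open>mhat\<close> computed inside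
    \<open>solver\<close>, so that \<open>inv_eq\<close> follows by unfolding.\<close>
  define li where "li = fst (power_iteration (inverse_mat A ^\<^sub>m 2) (\<omega> 0) k)"
  define lf where "lf = fst (power_iteration (A ^\<^sub>m 2) (\<omega> 1) k)"
  define mh where "mh = sqrt (1.5 * lf)"
  define J where "J = \<lceil>log 2 (mh / sqrt (0.5 / li))\<rceil>"
  define k' where "k' = (if J \<ge> 1
    then nat \<lceil>2.9 * log 10 (real N) + 1.8 * log 2 (real_of_int J) + 40.3\<rceil> else k)"
  have inv_eq: "num_inv (solver A \<omega>) = 2 * (k + 1) + snd (solver_loop A \<omega> mh k' (nat J) 0 0)"
    using A
    by (simp add: solver_def Let_def case_prod_beta snd_power_iteration
        k_def li_def lf_def mh_def J_def k'_def)
  have n: "1 \<le> n" unfolding n_def by (rule one_le_ln_real[OF N])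
  have log10: "log 10 (real N) \<le> n" unfolding n_def using N by (intro log10_le_ln) simp
  have log10_0: "0 \<le> log 10 (real N)" using N by simp
  have kappa: "0 < \<kappa>" using cond less_le_trans[OF exp_gt_zero] unfolding \<kappa>_def by blast
  have L: "4 \<le> L" unfolding L_def using cond kappa by (subst ln_ge_iff) (simp_all add: \<kappa>_def)
  \<comment> \<open>The double logarithm dominates \<open>ln L\<close>, which is at least 1 as
    \<open>L\<close> exceeds \<open>exp 1\<close>. Hence \<open>LL\<close> can absorb
    constants.\<close>
  have "L \<le> ln (1 + \<kappa>)" unfolding L_def using kappa by simp
  hence LL_L: "ln L \<le> LL" unfolding LL_def using L by simp
  have "1 \<le> ln L" using L exp_le by (subst ln_ge_iff) simp_all
  hence LL: "1 \<le> LL" using LL_L by linarith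
  note B = inverse_mat_props(1)[OF A inv]
  have lf: "lf \<in> {0..(spectral_norm A)\<^sup>2}"
    unfolding lf_def by (intro power_iteration_square_bounds[OF A sym] oracle_carrier[OF \<omega>])
  have li: "li \<in> {0..(spectral_norm (inverse_mat A))\<^sup>2}"
    unfolding li_def
    by (intro power_iteration_square_bounds[OF B symmetric_inverse_mat[OF A sym inv]]
        oracle_carrier[OF \<omega>])
  have "0 < N" using N by simp
  have "mh / sqrt (0.5 / li) \<le> 2 * \<kappa>"
    unfolding mh_def \<kappa>_def condition_number_def
    by (rule sqrt_quotient_le[OF lf li spectral_norm_nonneg[OF A \<open>0 < N\<close>]
        spectral_norm_nonneg[OF B \<open>0 < N\<close>]])
  moreover have "0 \<le> mh / sqrt (0.5 / li)" using lf li by (simp add: mh_def)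
  ultimately have J: "real_of_int J \<le> 2 * L"
    unfolding J_def L_def using L kappa by (intro ceiling_log2_le) (auto simp: L_def)
  have "real k \<le> 2.9 * log 10 (real N) + 54.1 + 1"
    unfolding k_def using log10_0 by (intro real_nat_ceiling_le) simp
  hence k: "real (k + 1) \<le> 59 * n" using log10 n by simp
  \<comment> \<open>The factor 52 rounds up \<open>2.9 + 5.4 + 42.3\<close>, where 5.4 is
    \<open>1.8 * 3\<close> and 42.3 is 40.3 plus one for the ceiling and one for the extra pass. If
    \<open>J\<close> is below 1, then \<open>nat J = 0\<close> and there are no passes.\<close>
  have k': "real (nat J) * real (k' + 1) \<le> 2 * L * (52 * (n * LL))"
  proof (cases "J \<ge> 1")
    case True
    hence J1: "1 \<le> real_of_int J" by linarith
    have "log 2 (real_of_int J) \<le> 3 / 2 * ln (real_of_int J)" by (rule log2_le_ln[OF J1])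
    also have "\<dots> \<le> 3 / 2 * ln (2 * L)" using J J1 by simp
    also have "\<dots> = 3 / 2 * (ln 2 + ln L)" using L by (simp add: ln_mult)
    \<comment> \<open>Both \<open>ln 2\<close> and \<open>ln L\<close> are at most
      \<open>LL\<close>.\<close>
    also have "\<dots> \<le> 3 * LL" using LL_L LL ln_2_less_1 by simp
    finally have log2: "log 2 (real_of_int J) \<le> 3 * LL" .
    have "real k' \<le> 2.9 * log 10 (real N) + 1.8 * log 2 (real_of_int J) + 40.3 + 1"
      unfolding k'_def using True log10_0 J1 by (simp only: if_True) (intro real_nat_ceiling_le, simp)
    hence "real (k' + 1) \<le> 2.9 * n + 5.4 * LL + 42.3" using log10 log2 by simp
    also have "\<dots> \<le> 52 * (n * LL)"
    proof -
      have "n * 1 \<le> n * LL" "1 * LL \<le> n * LL" using n LL by (intro mult_mono; simp)+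
      thus ?thesis using n by linarith
    qed
    finally have "real (k' + 1) \<le> 52 * (n * LL)" .
    moreover have "real (nat J) \<le> 2 * L" using True J by simp
    ultimately show ?thesis by (intro mult_mono) (use L in auto)
  qed (use L n LL in simp)
  have "snd (solver_loop A \<omega> mh k' (nat J) 0 0) \<le> nat J * (k' + 1)"
    using snd_solver_loop_le[of A \<omega> mh k' "nat J" 0 0] by simp
  hence "real (snd (solver_loop A \<omega> mh k' (nat J) 0 0)) \<le> real (nat J) * real (k' + 1)"
    unfolding of_nat_mult[symmetric] of_nat_le_iff .
  hence "real (num_inv (solver A \<omega>)) \<le> 118 * n + 104 * (L * (n * LL))"
    unfolding inv_eq using k k' by simp
  \<comment> \<open>Both terms are brought to the common form \<open>L\<^sup>2 * (n * LL)\<close>;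
    the coefficients 118 and 104 then add up to 222, below 250.\<close>
  also have "\<dots> \<le> 118 * (L\<^sup>2 * (n * LL)) + 104 * (L\<^sup>2 * (n * LL))"
  proof -
    have L2: "L \<le> L\<^sup>2" "1 \<le> L\<^sup>2"
      using L one_le_power[of L 2] by (simp_all add: power2_eq_square)
    have "n \<le> n * LL" using mult_left_mono[of 1 LL n] n LL by simp
    also have "\<dots> \<le> L\<^sup>2 * (n * LL)"
      using mult_right_mono[OF L2(2), of "n * LL"] n LL by simp
    finally have "n \<le> L\<^sup>2 * (n * LL)" .
    moreover have "L * (n * LL) \<le> L\<^sup>2 * (n * LL)"
      using L2(1) n LL by (intro mult_right_mono) auto
    ultimately show ?thesis by linarith
  qed
  also have "\<dots> \<le> 250 * n * L\<^sup>2 * LL" using n LL by (simp add: mult_ac)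
  finally show ?thesis unfolding n_def L_def LL_def \<kappa>_def .
qed

theorem mainTheorem2:
  shows "\<exists>(C::real) (N0::nat) (\<kappa>0::real). C > 0 \<and> N0 > 0 \<and> \<kappa>0 > 0 \<and>
    (\<forall>N \<ge> N0. \<forall>A :: real mat.
       A \<in> carrier_mat N N \<longrightarrow> symmetric_mat A \<longrightarrow> invertible_mat A \<longrightarrow>
       condition_number A \<ge> \<kappa>0 \<longrightarrow>
         (\<forall>\<omega> \<in> space (random_oracle N). real (num_for (solver A \<omega>)) \<le> C * ln (real N)) \<and>
         measure (random_oracle N)
           {\<omega> \<in> space (random_oracle N).
              real (num_inv (solver A \<omega>)) \<le>
                C * ln (real N) * (ln (condition_number A))\<^sup>2
                  * ln (ln (1 + condition_number A))}
           > 1 - 1 / 10 ^ 9)"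
\<comment> \<open>The constant 250 serves both counts, 3 ensures \<open>ln (real N)\<close> at least
  1, and \<open>exp 4\<close> provides the lower bound 4 on the logarithm of the condition
  number.\<close>
proof (rule exI[of _ 250], rule exI[of _ 3], rule exI[of _ "exp 4"],
    intro conjI allI impI ballI)
  fix N :: nat and A :: "real mat"
  assume N: "3 \<le> N" and A: "A \<in> carrier_mat N N" "symmetric_mat A" "invertible_mat A"
    and cond: "exp 4 \<le> condition_number A"
  show "real (num_for (solver A \<omega>)) \<le> 250 * ln (real N)" for \<omega>
    using num_for_solver_le[OF A(1) N, of \<omega>] one_le_ln_real[OF N] by simp
  \<comment> \<open>The event is the whole sample space, so it is measurable and has probability
    1.\<close>
  have all: "{\<omega> \<in> space (random_oracle N).
      real (num_inv (solver A \<omega>)) \<le> 250 * ln (real N) * (ln (condition_number A))\<^sup>2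
        * ln (ln (1 + condition_number A))} = space (random_oracle N)"
    using num_inv_solver_le[OF A N cond] by blast
  interpret prob_space "random_oracle N"
    using N by (intro prob_space_random_oracle) simp
  show "measure (random_oracle N) {\<omega> \<in> space (random_oracle N).
      real (num_inv (solver A \<omega>)) \<le> 250 * ln (real N) * (ln (condition_number A))\<^sup>2
        * ln (ln (1 + condition_number A))} > 1 - 1 / 10 ^ 9"
    unfolding all prob_space by simp
qed simp_all

end
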